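(* Let $a,b\ge 1$ and let $\rho$ be the canonical sequential form of a non-crossing partition of length $a$; if $b\ge 2$, assume further that $\rho$ starts with a single $1$ (i.e. its initial run of $1$'s has length exactly one), with no such restriction if $b=1$. Let $\tau=(\rho+1)1^b$. Then the generating function counting the members of $NC_n$ for $n\ge 0$ according to the number of occurrences of the subword $\tau$ is $$\sum_{n\ge 0}\Big(\sum_{\pi\in NC_n}q^{\mu_\tau(\pi)}\Big)x^n=\frac{1+2(q-1)x^{a+b-1}-\sqrt{1-4x-4(q-1)x^{a+b}}}{2x(1+(q-1)x^{a+b-2})}.$$
   Context: A set partition of $[n]=\{1,\dots,n\}$ with blocks $B_1,\dots,B_k$ ordered so that $\min B_1<\cdots<\min B_k$ is represented by its canonical sequential form $\pi=\pi_1\cdots\pi_n$, where $i\in B_{\pi_i}$ for each $i$; $n$ is its length. It is non-crossing if $\pi$ contains no (not necessarily consecutive) subsequence of the form $a\,b\,a\,b$ with $a<b$. $NC_n$ denotes the set of non-crossing partitions of $[n]$, identified with their canonical sequential forms ($NC_0$ consists of the empty partition). A subword pattern is a finite sequence $\tau=\tau_1\cdots\tau_k$ of positive integers whose set of distinct letters is $[\ell]$ for some $\ell$. An occurrence of $\tau$ in a sequence $\sigma_1\cdots\sigma_n$ is an index $i\in[n-k+1]$ such that the string of consecutive letters $\sigma_i\cdots\sigma_{i+k-1}$ is order-isomorphic to $\tau$ (same relative order, including equalities). $\mu_\tau(\pi)$ denotes the number of occurrences of $\tau$ in $\pi$. $\rho+1$ is the sequence obtained by adding $1$ to each entry of $\rho$,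 $1^b$ is the word of $b$ ones, and juxtaposition is concatenation. The formula is an identity of formal power series in $x$ (over $\mathbb{Q}(q)$), the square root being the one with constant term $1$. *)

theory Defs
  imports "HOL-Computational_Algebra.Computational_Algebra" "HOL-Library.Disjoint_Sets"
begin

(* List positions start at 0, whereas elements of {1..n} and block labels start at 1:
   the letter of the element i is w ! (i - 1), and the block labelled j is Bs ! (j - 1). *)
definition canonical_form :: "nat \<Rightarrow> nat set set \<Rightarrow> nat list \<Rightarrow> bool" where
  "canonical_form n P w \<longleftrightarrow>
     (\<exists>Bs. set Bs = P \<and> sorted_wrt (\<lambda>B C. Min B < Min C) Bs \<and> length w = n \<and>
        (\<forall>i\<in>{1..n}. w ! (i - 1) \<in> {1..length Bs} \<and> i \<in> Bs ! (w ! (i - 1) - 1)))"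

definition noncrossing :: "nat list \<Rightarrow> bool" where
  "noncrossing w \<longleftrightarrow>
     \<not> (\<exists>i j k l. i < j \<and> j < k \<and> k < l \<and> l < length w \<and>
          w ! i = w ! k \<and> w ! j = w ! l \<and> w ! i < w ! j)"

definition NC :: "nat \<Rightarrow> nat list set" where
  "NC n = {w. (\<exists>P. partition_on {1..n} P \<and> canonical_form n P w) \<and> noncrossing w}"

definition order_isomorphic :: "nat list \<Rightarrow> nat list \<Rightarrow> bool" where
  "order_isomorphic u v \<longleftrightarrow> length u = length v \<and>
     (\<forall>i<length u. \<forall>j<length u.
        (u ! i < u ! j \<longleftrightarrow> v ! i < v ! j) \<and> (u ! i = u ! j \<longleftrightarrow> v ! i = v ! j))"

definition occurrences :: "nat list \<Rightarrow> nat list \<Rightarrow> nat" where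
  "occurrences \<tau> w =
     card {i. i + length \<tau> \<le> length w \<and> order_isomorphic (take (length \<tau>) (drop i w)) \<tau>}"

text \<open>The indeterminate of the field of rational functions over the rationals.\<close>

definition qvar :: "rat poly fract" where
  "qvar = to_fract [:0, 1:]"

definition fps_sqrt :: "'a::field_char_0 fps \<Rightarrow> 'a fps" where
  "fps_sqrt f = fps_radical (\<lambda>_ _. 1) 2 f"

text \<open>Only meaningful for constant term 1, where it is the unique square root with constant term 1.\<close>

lemma fps_sqrt_iff:
  fixes f :: "'a::field_char_0 fps"
  assumes "fps_nth f 0 = 1"
  shows "g = fps_sqrt f \<longleftrightarrow> g ^ 2 = f \<and> fps_nth g 0 = 1"
proof -
  have "(\<lambda>_ _. 1::'a) (Suc 1) (fps_nth f 0) ^ Suc 1 = fps_nth f 0"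
    using assms by simp
  moreover have "fps_nth (fps_sqrt f) 0 = 1"
    by (simp add: fps_sqrt_def)
  ultimately show ?thesis
    using assms radical_unique[of "\<lambda>_ _. 1" 1 f g] power_radical[of f "\<lambda>_ _. 1" 1]
    by (auto simp: fps_sqrt_def numeral_2_eq_2)
qed

end

theory Submission
  imports Defs "HOL-Library.Sublist"
begin

text \<open>
  A nonempty non-crossing word is \<open>1 (\<alpha>+1) \<beta>'\<close>, where \<open>\<beta>'\<close> is empty or starts at the second
  occurrence of 1 and arises from a non-crossing word \<open>\<beta>\<close> by raising its letters other than 1
  above those of \<open>\<alpha>+1\<close>. Its occurrences of \<open>\<tau>\<close> are those of \<open>\<alpha>\<close>, those of \<open>\<beta>\<close>, and one more
  if \<open>\<alpha>\<close> ends in a copy of \<open>\<rho>\<close> and \<open>\<beta>\<close> starts with \<open>b\<close> ones. The words \<open>\<alpha>\<close> of this kind arise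
  from nonempty non-crossing words, with the same number of occurrences, by extending the last
  letter to a copy of \<open>\<rho>\<close> (\<open>a - 1\<close> additional letters), and the words \<open>\<beta>\<close> by prepending \<open>b - 1\<close>
  ones. Hence the generating function \<open>F\<close> satisfies
  \<open>F - 1 = x F\<^sup>2 + (q - 1) x\<^bsup>a+b-1\<^esup> (F - 1)\<^sup>2\<close>, and the theorem is the solution of this quadratic
  equation.
\<close>

section \<open>Restricted growth words\<close>

text \<open>\<open>rg_from m w\<close>: the word \<open>w\<close> continues a restricted growth word with maximum \<open>m\<close>.\<close>

fun rg_from :: "nat \<Rightarrow> nat list \<Rightarrow> bool" where
  "rg_from m [] = True"
| "rg_from m (x # w) = (1 \<le> x \<and> x \<le> Suc m \<and> rg_from (max m x) w)"

abbreviation letter_max :: "nat list \<Rightarrow> nat" where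
  "letter_max w \<equiv> fold max w 0"

lemma rg_from_append: "rg_from m (u @ v) \<longleftrightarrow> rg_from m u \<and> rg_from (fold max u m) v"
  by (induction u arbitrary: m) (auto simp: max.commute)

lemma rg_from_set: "rg_from m u \<Longrightarrow> {1..m} \<union> set u = {1..fold max u m}"
proof (induction u arbitrary: m)
  case (Cons x u)
  have "{1..m} \<union> {x} = {1..max m x}"
    using Cons.prems by (auto simp: max_def)
  moreover have "{1..max m x} \<union> set u = {1..fold max u (max m x)}"
    using Cons by simp
  ultimately show ?case
    by (auto simp: max.commute)
qed simp

lemma rg_set: "rg_from 0 w \<Longrightarrow> set w = {1..letter_max w}"
  using rg_from_set[of 0 w] by simp

text \<open>The prefix before position \<open>i\<close> uses exactly the letters from 1 to its
  maximum, and \<open>w ! i\<close> exceeds that maximum by at most 1.\<close>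

lemma rg_smaller_letter_before:
  assumes "rg_from 0 w" "i < length w" "1 \<le> j" "j < w ! i"
  shows "\<exists>k<i. w ! k = j"
proof -
  have w: "w = take i w @ w ! i # drop (Suc i) w"
    using assms(2) by (simp add: id_take_nth_drop)
  have "rg_from 0 (take i w @ w ! i # drop (Suc i) w)"
    using assms(1) w by simp
  hence rg: "rg_from 0 (take i w)" and "w ! i \<le> Suc (letter_max (take i w))"
    by (auto simp: rg_from_append)
  hence "j \<in> set (take i w)"
    using assms rg_set[OF rg] by auto
  thus ?thesis
    using assms(2) by (auto simp: in_set_conv_nth)
qed

text \<open>A form without running maximum, to be matched with block minima. For the converse, a
  last letter that is too large would require the successor of the maximum to occur earlier.\<close>

lemma rg_iff_nth:
  "rg_from 0 w \<longleftrightarrow>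
    (\<forall>i<length w. 1 \<le> w ! i \<and> (\<forall>j. 1 \<le> j \<and> j < w ! i \<longrightarrow> (\<exists>k<i. w ! k = j)))"
  (is "_ \<longleftrightarrow> ?R w")
proof
  assume rg: "rg_from 0 w"
  moreover have "1 \<le> w ! i" if "i < length w" for i
    using rg_set[OF rg] nth_mem[OF that] by auto
  ultimately show "?R w"
    using rg_smaller_letter_before by blast
next
  show "?R w \<Longrightarrow> rg_from 0 w"
  proof (induction w rule: rev_induct)
    case (snoc x w)
    have "?R w"
    proof (intro allI impI)
      fix i assume i: "i < length w"
      hence "1 \<le> (w @ [x]) ! i \<and> (\<forall>j. 1 \<le> j \<and> j < (w @ [x]) ! i \<longrightarrow> (\<exists>k<i. (w @ [x]) ! k = j))"
        using snoc.prems by (metis length_append_singleton less_SucI)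
      thus "1 \<le> w ! i \<and> (\<forall>j. 1 \<le> j \<and> j < w ! i \<longrightarrow> (\<exists>k<i. w ! k = j))"
        using i by (auto simp: nth_append) (metis less_trans)
    qed
    hence rg: "rg_from 0 w"
      by (rule snoc.IH)
    have x: "1 \<le> x" and pred: "\<And>j. 1 \<le> j \<Longrightarrow> j < x \<Longrightarrow> j \<in> set w"
      using snoc.prems[rule_format, of "length w"]
      by (auto simp: nth_append in_set_conv_nth) (metis (full_types))
    have "x \<le> Suc (letter_max w)"
      using pred[of "Suc (letter_max w)"] rg_set[OF rg] by fastforce
    thus ?case
      using rg x by (simp add: rg_from_append)
  qed simp
qed

section \<open>Crossings\<close>

text \<open>Applied repeatedly, this turns a subsequence into a chain of increasing
  positions.\<close>

lemma subseq_Cons_drop_iff: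
  "subseq (x # xs) (drop n w) \<longleftrightarrow>
    (\<exists>i. n \<le> i \<and> i < length w \<and> w ! i = x \<and> subseq xs (drop (Suc i) w))"
proof
  assume "subseq (x # xs) (drop n w)"
  then obtain us vs where uv: "drop n w = us @ x # vs" "subseq xs vs"
    by (auto dest: list_emb_ConsD)
  have "n + length us < length w"
    using arg_cong[OF uv(1), of length] by simp
  moreover have "w ! (n + length us) = x"
    using arg_cong[OF uv(1), of "\<lambda>u. u ! length us"] calculation by simp
  moreover have "drop (Suc (n + length us)) w = vs"
    using arg_cong[OF uv(1), of "drop (Suc (length us))"] by (simp add: add.commute)
  ultimately show "\<exists>i. n \<le> i \<and> i < length w \<and> w ! i = x \<and> subseq xs (drop (Suc i) w)"
    using uv(2) by (intro exI[of _ "n + length us"]) auto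
next
  assume "\<exists>i. n \<le> i \<and> i < length w \<and> w ! i = x \<and> subseq xs (drop (Suc i) w)"
  then obtain i where i: "n \<le> i" "i < length w" "w ! i = x" "subseq xs (drop (Suc i) w)"
    by blast
  have "drop i w = x # drop (Suc i) w"
    using i by (auto simp: Cons_nth_drop_Suc)
  moreover have "drop n w = take (i - n) (drop n w) @ drop i w"
    using i(1) append_take_drop_id[of "i - n" "drop n w"] by (simp del: append_take_drop_id)
  ultimately show "subseq (x # xs) (drop n w)"
    using i(4) by (metis subseq_Cons2 subseq_drop_many)
qed

text \<open>Subsequences split along \<open>@\<close> and \<open>#\<close>, which spares position
  arithmetic in the proofs about composite words.\<close>

lemma noncrossing_iff_subseq:
  "noncrossing w \<longleftrightarrow> (\<forall>x y. x < y \<longrightarrow> \<not> subseq [x, y, x, y] w)"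
proof -
  have *: "subseq [x, y, x, y] w \<longleftrightarrow>
     (\<exists>i j k l. i < j \<and> j < k \<and> k < l \<and> l < length w \<and> w ! i = x \<and> w ! j = y \<and> w ! k = x \<and> w ! l = y)"
    for x y
    using subseq_Cons_drop_iff[of x "[y, x, y]" 0 w]
    by (auto simp: subseq_Cons_drop_iff Suc_le_eq)
  show ?thesis
  proof (intro iffI allI impI notI)
    fix x y assume "noncrossing w" "x < y" "subseq [x, y, x, y] w"
    thus False
      unfolding noncrossing_def * by metis
  next
    assume no: "\<forall>x y. x < y \<longrightarrow> \<not> subseq [x, y, x, y] w"
    show "noncrossing w"
      unfolding noncrossing_def
    proof (rule notI, elim exE conjE)
      fix i j k l
      assume "i < j" "j < k" "k < l" "l < length w" "w ! i = w ! k" "w ! j = w ! l" "w ! i < w ! j"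
      thus False
        using no[rule_format, of "w ! i" "w ! j"] unfolding * by metis
    qed
  qed
qed

lemma subseq_set_subset: "subseq u w \<Longrightarrow> set u \<subseteq> set w"
  by (auto elim: list_emb_set)

text \<open>Restricted growth puts \<open>x\<close> before every position that carries
  \<open>y\<close>. Hence a subsequence \<open>y x y\<close> with \<open>x < y\<close> already
  forces the crossing \<open>x y x y\<close>.\<close>

lemma subseq_rg_letter_before:
  assumes "rg_from 0 w" "1 \<le> x" "x < y" "subseq (y # ys) w"
  shows "subseq (x # y # ys) w"
proof -
  obtain i where i: "i < length w" "w ! i = y" "subseq ys (drop (Suc i) w)"
    using assms(4) subseq_Cons_drop_iff[of y ys 0 w] by auto
  obtain k where k: "k < i" "w ! k = x"
    using rg_smaller_letter_before[OF assms(1) i(1) assms(2)] assms(3) i(2) by auto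
  have "subseq (y # ys) (drop (Suc k) w)"
    using i k by (auto simp: subseq_Cons_drop_iff Suc_le_eq)
  thus ?thesis
    using subseq_Cons_drop_iff[of x "y # ys" 0 w] i k by auto
qed

lemma noncrossing_subseq: "noncrossing w \<Longrightarrow> subseq u w \<Longrightarrow> noncrossing u"
  unfolding noncrossing_iff_subseq using subseq_order.trans by blast

lemma noncrossing_map:
  assumes "noncrossing w" "strict_mono_on (set w) f"
  shows "noncrossing (map f w)"
  unfolding noncrossing_def
proof (rule notI, elim exE conjE)
  fix i j k l
  assume ord: "i < j" "j < k" "k < l" "l < length (map f w)"
    and eq: "map f w ! i = map f w ! k" "map f w ! j = map f w ! l"
    and less: "map f w ! i < map f w ! j"
  have "w ! i = w ! k" "w ! j = w ! l"
    using ord eq strict_mono_on_eqD[OF assms(2)] by auto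
  moreover have "w ! i < w ! j"
    using ord less strict_mono_on_less[OF assms(2)] by auto
  ultimately show False
    using assms(1) ord unfolding noncrossing_def by auto
qed

section \<open>Canonical forms as restricted growth words\<close>

definition NCW :: "nat list set" where
  "NCW = {w. rg_from 0 w \<and> noncrossing w}"

text \<open>For \<open>j < w ! i\<close>, the minimum of block \<open>j\<close> lies below that of
  the block of \<open>Suc i\<close> and so gives an earlier position with letter \<open>j\<close>.
  Conversely, the blocks are the sets of elements carrying the same letter, listed by
  letter.\<close>

lemma canonical_form_iff_rg:
  "(\<exists>P. partition_on {1..n} P \<and> canonical_form n P w) \<longleftrightarrow> length w = n \<and> rg_from 0 w"
proof
  assume "\<exists>P. partition_on {1..n} P \<and> canonical_form n P w"
  then obtain Bs where part: "partition_on {1..n} (set Bs)"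
    and sorted: "sorted_wrt (\<lambda>B C. Min B < Min C) Bs" and len: "length w = n"
    and w: "\<And>i. i \<in> {1..n} \<Longrightarrow> w ! (i - 1) \<in> {1..length Bs} \<and> i \<in> Bs ! (w ! (i - 1) - 1)"
    unfolding canonical_form_def by auto
  \<comment> \<open>Two blocks sharing an element are equal by disjointness, and the strictly
    increasing minima exclude repetitions in the list.\<close>
  have inj: "j = k" if "j < length Bs" "k < length Bs" "i \<in> Bs ! j" "i \<in> Bs ! k" for i j k
  proof (rule ccontr)
    assume "j \<noteq> k"
    have "Bs ! j = Bs ! k"
      using part that by (meson disjoint_iff nth_mem partition_onD2 disjointD)
    moreover have "Min (Bs ! j) \<noteq> Min (Bs ! k)"
      using \<open>j \<noteq> k\<close> sorted that by (metis linorder_neqE_nat less_irrefl sorted_wrt_iff_nth_less)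
    ultimately show False by simp
  qed
  have "\<exists>k<i. w ! k = j" if i: "i < length w" and j: "1 \<le> j" "j < w ! i" for i j
  proof -
    define B where "B = Bs ! (j - 1)"
    have wi: "w ! i \<le> length Bs" "Suc i \<in> Bs ! (w ! i - 1)"
      using w[of "Suc i"] i len by auto
    have BP: "B \<in> set Bs" and CP: "Bs ! (w ! i - 1) \<in> set Bs"
      using wi j by (auto simp: B_def)
    have "C \<subseteq> {1..n}" "finite C" "C \<noteq> {}" if "C \<in> set Bs" for C
      using that part finite_subset[of C "{1..n}"] by (auto simp: partition_on_def)
    note * = this
    have "Min B < Min (Bs ! (w ! i - 1))"
      unfolding B_def using sorted j wi by (intro sorted_wrt_nth_less[OF sorted]) auto
    also have "\<dots> \<le> Suc i"
      using * CP wi(2) by auto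
    finally have lt: "Min B < Suc i" .
    have MB: "Min B \<in> B" "Min B \<in> {1..n}"
      using *[OF BP] Min_in[of B] by blast+
    have "w ! (Min B - 1) - 1 = j - 1"
      by (rule inj[of _ _ "Min B"]) (use w[OF MB(2)] MB(1) j wi in \<open>auto simp: B_def\<close>)
    hence "w ! (Min B - 1) = j"
      using w[OF MB(2)] j by auto
    thus ?thesis
      using lt MB(2) by (intro exI[of _ "Min B - 1"]) auto
  qed
  moreover have "1 \<le> w ! i" if "i < length w" for i
    using w[of "Suc i"] that len by auto
  ultimately show "length w = n \<and> rg_from 0 w"
    using len by (simp add: rg_iff_nth)
next
  assume w: "length w = n \<and> rg_from 0 w"
  define m where "m = letter_max w"
  define B where "B j = {i \<in> {1..n}. w ! (i - 1) = j}" for j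
  define Bs where "Bs = map B [1..<Suc m]"
  have len: "length Bs = m"
    by (simp add: Bs_def)
  have Bs: "Bs ! (j - 1) = B j" if "j \<in> {1..m}" for j
  proof -
    have "Bs ! (j - 1) = B ([1..<Suc m] ! (j - 1))"
      unfolding Bs_def using that by (intro nth_map) auto
    also have "[1..<Suc m] ! (j - 1) = j"
      using that by (subst nth_upt) auto
    finally show ?thesis .
  qed
  have setw: "set w = {1..m}"
    using rg_set w m_def by simp
  have letter: "w ! (i - 1) \<in> {1..m}" if "i \<in> {1..n}" for i
    using that w setw nth_mem[of "i - 1" w] by auto
  have ne: "B j \<noteq> {}" if "j \<in> {1..m}" for j
  proof -
    obtain i where "i < length w" "w ! i = j"
      using \<open>j \<in> {1..m}\<close> setw by (metis in_set_conv_nth)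
    hence "Suc i \<in> B j"
      using w by (auto simp: B_def)
    thus ?thesis by blast
  qed
  have "partition_on {1..n} (set Bs)"
  proof (rule partition_onI)
    show "\<Union> (set Bs) = {1..n}"
      using letter by (fastforce simp: Bs_def B_def)
  next
    show "disjnt p q" if "p \<in> set Bs" "q \<in> set Bs" "p \<noteq> q" for p q
      using that by (auto simp: Bs_def B_def disjnt_def)
  next
    show "{} \<notin> set Bs"
      using ne by (fastforce simp: Bs_def simp del: upt_Suc)
  qed
  moreover have "sorted_wrt (\<lambda>B C. Min B < Min C) Bs"
    unfolding sorted_wrt_iff_nth_less
  proof (intro allI impI)
    fix i j assume ij: "i < j" "j < length Bs"
    have fin: "finite (B k)" for k by (simp add: B_def)
    have "Min (B (Suc j)) \<in> B (Suc j)"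
      using ne[of "Suc j"] ij len fin by (intro Min_in) auto
    moreover define l where "l = Min (B (Suc j))"
    ultimately have l: "l \<in> {1..n}" "w ! (l - 1) = Suc j"
      by (auto simp: B_def)
    have "l - 1 < length w"
      using w l by auto
    \<comment> \<open>Restricted growth places \<open>Suc i\<close> before the first
      \<open>Suc j\<close>, so block \<open>Suc i\<close> has an element below
      \<open>l\<close>.\<close>
    then obtain k where k: "k < l - 1" "w ! k = Suc i"
      using rg_smaller_letter_before[of w "l - 1" "Suc i"] w l ij by auto
    have "Suc k \<in> B (Suc i)"
      using k l by (auto simp: B_def)
    hence "Min (B (Suc i)) \<le> Suc k"
      using fin by simp
    thus "Min (Bs ! i) < Min (Bs ! j)"
      using Bs[of "Suc i"] Bs[of "Suc j"] ij len k(1) by (simp add: l_def)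
  qed
  moreover have "w ! (i - 1) \<in> {1..length Bs} \<and> i \<in> Bs ! (w ! (i - 1) - 1)"
    if "i \<in> {1..n}" for i
    using letter[OF that] Bs[OF letter[OF that]] that by (simp add: len B_def)
  ultimately show "\<exists>P. partition_on {1..n} P \<and> canonical_form n P w"
    unfolding canonical_form_def using w by blast
qed

lemma NC_eq: "NC n = {w \<in> NCW. length w = n}"
  unfolding NC_def NCW_def using canonical_form_iff_rg by auto


section \<open>Splitting a word at the second occurrence of the letter 1\<close>

lemma NCW_Nil [simp]: "[] \<in> NCW"
  by (simp add: NCW_def noncrossing_def)

lemma NCW_set: "w \<in> NCW \<Longrightarrow> set w = {1..letter_max w}"
  by (simp add: NCW_def rg_set)

lemma NCW_pos: "w \<in> NCW \<Longrightarrow> x \<in> set w \<Longrightarrow> 1 \<le> x"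
  using NCW_set by auto

lemma NCW_Cons: "x # w \<in> NCW \<Longrightarrow> x = 1"
  by (simp add: NCW_def)

text \<open>The definition of \<open>noncrossing\<close> only covers \<open>x < y\<close>. For
  \<open>x > y\<close>, restricted growth supplies a \<open>y\<close> before the first
  \<open>x\<close>, and \<open>y x y x\<close> is then a crossing.\<close>

lemma NCW_no_crossing:
  assumes "w \<in> NCW" "x \<noteq> y"
  shows "\<not> subseq [x, y, x, y] w"
proof
  assume sub: "subseq [x, y, x, y] w"
  hence "{x, y} \<subseteq> set w"
    using subseq_set_subset by fastforce
  hence pos: "1 \<le> x" "1 \<le> y"
    using NCW_pos[OF assms(1)] by auto
  have w: "rg_from 0 w" "noncrossing w"
    using assms(1) by (auto simp: NCW_def)
  show False
  proof (cases "x < y")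
    case True
    thus False
      using sub w(2) noncrossing_iff_subseq by blast
  next
    case False
    hence "subseq (y # x # [y, x, y]) w"
      using subseq_rg_letter_before[OF w(1) pos(2), of x] assms(2) sub by simp
    hence "subseq [y, x, y, x] w"
      using subseq_order.trans[of "[y, x, y, x]" "[y, x, y, x, y]" w] by auto
    thus False
      using False assms(2) w(2) noncrossing_iff_subseq by (metis linorder_neqE_nat)
  qed
qed

lemma subseq_map_inj:
  assumes "subseq xs (map f ys)"
  obtains zs where "xs = map f zs" "subseq zs ys"
proof -
  obtain N where "xs = nths (map f ys) N"
    using assms by (auto simp: subseq_conv_nths)
  thus ?thesis
    using that[of "nths ys N"] by (auto simp: nths_map subseq_conv_nths)
qed

text \<open>The 1s of the second part join the block of the leading 1; the letters from 2 on move
  above \<open>Suc m\<close>, the largest letter of \<open>map Suc u\<close> when \<open>u\<close>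
  has maximum \<open>m\<close>.\<close>

definition lift_letter :: "nat \<Rightarrow> nat \<Rightarrow> nat" where
  "lift_letter m x = (if x = 1 then 1 else x + m)"

definition join :: "nat list \<times> nat list \<Rightarrow> nat list" where
  "join = (\<lambda>(u, v). 1 # map Suc u @ map (lift_letter (letter_max u)) v)"

lemma strict_mono_on_lift_letter: "strict_mono_on {1..} (lift_letter m)"
  by (auto simp: strict_mono_on_def lift_letter_def)

lemma rg_from_map_Suc: "rg_from m u \<Longrightarrow> rg_from (Suc m) (map Suc u)"
  by (induction u arbitrary: m) (auto simp: max_def)

lemma fold_max_map_Suc: "fold max (map Suc u) (Suc m) = Suc (fold max u m)"
  by (induction u arbitrary: m) (simp_all add: max_def)

lemma rg_from_map_lift_letter:
  "1 \<le> k \<Longrightarrow> rg_from k v \<Longrightarrow> rg_from (m + k) (map (lift_letter m) v)"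
proof (induction v arbitrary: k)
  case (Cons x v)
  have "max (m + k) (lift_letter m x) = m + max k x"
    using Cons.prems by (auto simp: lift_letter_def)
  thus ?case
    using Cons.IH[of "max k x"] Cons.prems by (auto simp: lift_letter_def)
qed simp

lemma join_rg:
  assumes "rg_from 0 u" "rg_from 0 v"
  shows "rg_from 0 (join (u, v))"
proof (cases v)
  case Nil
  thus ?thesis
    using rg_from_map_Suc[OF assms(1)] by (simp add: join_def)
next
  case (Cons x v')
  hence "x = 1" "rg_from 1 v'"
    using assms(2) by auto
  thus ?thesis
    using rg_from_map_Suc[OF assms(1)] rg_from_map_lift_letter[of 1 v' "letter_max u"] Cons
      fold_max_map_Suc[of u 0]
    by (simp add: join_def rg_from_append lift_letter_def)
qed

text \<open>Apart from 1, the letters of \<open>A\<close> and \<open>B\<close> are separated by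
  \<open>Suc m\<close>. If \<open>y\<close> is in \<open>A\<close>, then the whole crossing lies in
  \<open>1 # A\<close>, hence in \<open>A\<close>. Otherwise \<open>y x y\<close> lies in
  \<open>B\<close> and pulls back to \<open>v\<close>, where restricted growth completes it to a
  crossing.\<close>

lemma join_noncrossing:
  assumes u: "u \<in> NCW" and v: "v \<in> NCW"
  shows "noncrossing (join (u, v))"
proof -
  define m where "m = letter_max u"
  define A where "A = map Suc u"
  define B where "B = map (lift_letter m) v"
  have j: "join (u, v) = 1 # A @ B"
    by (simp add: join_def A_def B_def m_def)
  have A: "set A = {2..Suc m}"
    using NCW_set[OF u] by (simp add: A_def m_def numeral_2_eq_2)
  have B: "x = 1 \<or> Suc m < x" if "x \<in> set B" for x
    using that NCW_pos[OF v] by (fastforce simp: B_def lift_letter_def)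
  have "False" if xy: "x < y" "subseq [x, y, x, y] (1 # A @ B)" for x y
  proof -
    have xyAB: "x \<in> set (1 # A @ B)" "y \<in> set (1 # A @ B)"
      using subseq_set_subset[OF xy(2)] by auto
    have "1 \<le> x"
      using xyAB A B by fastforce
    have yxy: "subseq [y, x, y] (A @ B)"
      using xy(2) xyAB \<open>1 \<le> x\<close> xy(1) by (cases "x = 1") (auto dest: subseq_Cons')
    show False
    proof (cases "y \<in> set A")
      case True
      hence yB: "y \<notin> set B"
        using A B by fastforce
      from xy(2) obtain p s where ps: "[x, y, x, y] = p @ s" "subseq p (1 # A)" "subseq s B"
        using subseq_append_iff[of "[x, y, x, y]" "1 # A" B] by auto
      have "s = []"
      proof (rule ccontr)
        assume "s \<noteq> []"
        hence "last s \<in> set B"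
          using subseq_set_subset[OF ps(3)] by auto
        moreover have "last s = y"
          using ps(1) \<open>s \<noteq> []\<close> by (metis last.simps last_appendR list.distinct(1))
        ultimately show False using yB by simp
      qed
      hence sub: "subseq [x, y, x, y] (1 # A)"
        using ps by simp
      hence "subseq [y, x, y] A"
        using \<open>1 \<le> x\<close> xy(1) by (cases "x = 1") (auto dest: subseq_Cons')
      hence "x \<in> set A"
        using subseq_set_subset by fastforce
      hence "x \<noteq> 1"
        using A by auto
      hence "subseq [x, y, x, y] A"
        using subseq_Cons2_neq[OF sub] by simp
      hence "\<not> noncrossing A"
        using xy(1) noncrossing_iff_subseq by blast
      moreover have "noncrossing A"
        unfolding A_def using u by (intro noncrossing_map) (auto simp: NCW_def strict_mono_on_def)
      ultimately show False by simp
    next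
      case False
      from yxy obtain p s where ps: "[y, x, y] = p @ s" "subseq p A" "subseq s B"
        using subseq_append_iff[of "[y, x, y]" A B] by auto
      have "p = []"
      proof (rule ccontr)
        assume "p \<noteq> []"
        hence "hd p \<in> set A" using subseq_set_subset[OF ps(2)] by auto
        moreover have "hd p = y"
          using ps(1) \<open>p \<noteq> []\<close> by (metis hd_append2 list.sel(1))
        ultimately show False using False by simp
      qed
      hence "subseq [y, x, y] (map (lift_letter m) v)"
        using ps B_def by simp
      then obtain zs where zs: "[y, x, y] = map (lift_letter m) zs" "subseq zs v"
        by (rule subseq_map_inj)
      then obtain y1 x1 y2 where z: "zs = [y1, x1, y2]" "lift_letter m y1 = y"
        "lift_letter m x1 = x" "lift_letter m y2 = y"
        by (auto simp: map_eq_Cons_conv Cons_eq_map_conv)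
      have pos: "1 \<le> y1" "1 \<le> x1" "1 \<le> y2"
        using subseq_set_subset[OF zs(2)] NCW_pos[OF v] z(1) by auto
      have "y1 = y2"
        using strict_mono_on_eqD[OF strict_mono_on_lift_letter, of m y2 y1] z(2,4) pos by simp
      moreover have "x1 < y1"
        using strict_mono_on_less[OF strict_mono_on_lift_letter, of x1 y1 m] z(2,3) pos xy(1)
        by simp
      ultimately have "subseq [x1, y1, x1, y1] v"
        using subseq_rg_letter_before[of v x1 y1 "[x1, y1]"] zs(2) z(1) v pos by (auto simp: NCW_def)
      thus False
        using NCW_no_crossing[OF v, of x1 y1] \<open>x1 < y1\<close> by simp
    qed
  qed
  thus ?thesis
    unfolding j noncrossing_iff_subseq by blast
qed

lemma join_NCW: "u \<in> NCW \<Longrightarrow> v \<in> NCW \<Longrightarrow> join (u, v) \<in> NCW - {[]}"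
  using join_noncrossing join_rg by (auto simp: NCW_def join_def)

text \<open>The letters of \<open>map Suc u\<close> are at least 2, so \<open>u\<close> is read off
  between the leading 1 and the next 1 or the end; then \<open>v\<close> follows, since
  \<open>lift_letter\<close> is injective on positive letters.\<close>

lemma inj_on_join: "inj_on join (NCW \<times> NCW)"
proof (rule inj_onI, clarify)
  fix u v u' v'
  assume uv: "u \<in> NCW" "v \<in> NCW" "u' \<in> NCW" "v' \<in> NCW" and eq: "join (u, v) = join (u', v')"
  have tw: "takeWhile (\<lambda>x. x \<noteq> 1) (tl (join (s, t))) = map Suc s"
    if "s \<in> NCW" "t \<in> NCW" for s t
  proof -
    have "takeWhile (\<lambda>x. x \<noteq> 1) (map (lift_letter m) t) = []" for m
      using that(2) NCW_Cons by (cases t) (auto simp: lift_letter_def)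
    moreover have "takeWhile (\<lambda>x. x \<noteq> 1) (map Suc s @ r) = map Suc s @ takeWhile (\<lambda>x. x \<noteq> 1) r" for r
      by (rule takeWhile_append2) (use NCW_pos[OF that(1)] in force)
    ultimately show ?thesis
      by (simp add: join_def)
  qed
  have u: "u = u'"
    using tw[OF uv(1,2)] tw[OF uv(3,4)] eq by (simp add: inj_map_eq_map)
  have "map (lift_letter (letter_max u)) v = map (lift_letter (letter_max u)) v'"
    using eq u by (simp add: join_def)
  moreover have "inj_on (lift_letter (letter_max u)) (set v \<union> set v')"
    using NCW_pos[OF uv(2)] NCW_pos[OF uv(4)]
    by (auto intro!: strict_mono_on_imp_inj_on monotone_on_subset[OF strict_mono_on_lift_letter])
  ultimately show "u = u' \<and> v = v'"
    using u by (simp add: inj_on_map_eq_map)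
qed

text \<open>The word is cut just before its second 1, or at its end if there is none. A letter
  \<open>x \<noteq> 1\<close> on both sides would give the crossing \<open>1 x 1 x\<close>, so the
  letters other than 1 on the right are new and can be lowered.\<close>

lemma join_surj:
  assumes w: "w \<in> NCW" "w \<noteq> []"
  shows "\<exists>u\<in>NCW. \<exists>v\<in>NCW. w = join (u, v)"
proof -
  obtain w' where w': "w = 1 # w'"
    using w NCW_Cons by (cases w) auto
  define A where "A = takeWhile (\<lambda>x. x \<noteq> 1) w'"
  define B where "B = dropWhile (\<lambda>x. x \<noteq> 1) w'"
  define u where "u = map (\<lambda>x. x - 1) A"
  define m where "m = letter_max u"
  define v where "v = map (\<lambda>x. if x = 1 then 1 else x - m) B"
  have AB: "w = 1 # A @ B"
    by (simp add: w' A_def B_def)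
  have B1: "B = [] \<or> (\<exists>B'. B = 1 # B')"
    using hd_dropWhile[of "\<lambda>x. x \<noteq> 1" w', folded B_def] by (cases B) auto
  have A2: "2 \<le> x" if "x \<in> set A" for x
    using that set_takeWhileD[of x "\<lambda>x. x \<noteq> 1" w'] NCW_pos[OF w(1), of x]
    by (auto simp: A_def w')
  have Au: "A = map Suc u"
    unfolding u_def map_map by (rule sym, rule map_idI) (use A2 in fastforce)
  have rgA: "rg_from (Suc 0) (map Suc u)" and rgB: "rg_from (Suc m) B"
    using w(1) fold_max_map_Suc[of u 0] by (auto simp: NCW_def AB Au rg_from_append m_def)
  have "rg_from k t" if "rg_from (Suc k) (map Suc t)" "\<forall>x\<in>set t. 1 \<le> x" for k t
    using that by (induction t arbitrary: k) auto
  moreover have "\<forall>x\<in>set u. 1 \<le> x"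
    using A2 by (fastforce simp: u_def)
  ultimately have rgu: "rg_from 0 u"
    using rgA by blast
  have setA: "set A = {2..Suc m}"
    using rg_set[OF rgu] by (simp add: Au m_def numeral_2_eq_2)
  have Bm: "Suc m < x" if xB: "x \<in> set B" "x \<noteq> 1" for x
  proof (rule ccontr)
    assume "\<not> Suc m < x"
    hence "x \<in> set A"
      using NCW_pos[OF w(1), of x] xB setA by (auto simp: AB)
    hence "subseq [x] A"
      by (simp add: subseq_singleton_left)
    moreover obtain B' where B': "B = 1 # B'"
      using B1 xB(1) by auto
    hence "subseq [1, x] B"
      using xB by (simp add: subseq_singleton_left)
    ultimately have "subseq ([x] @ [1, x]) (A @ B)"
      by (rule list_emb_append_mono)
    hence "subseq [1, x, 1, x] w"
      by (simp add: AB)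
    thus False
      using NCW_no_crossing[OF w(1)] xB(2) by metis
  qed
  have Bv: "B = map (lift_letter m) v"
    unfolding v_def map_map
    by (rule sym, rule map_idI) (use Bm in \<open>force simp: lift_letter_def\<close>)
  have v1: "1 \<le> x" if "x \<in> set v" for x
    using that Bm by (fastforce simp: v_def)
  have rgv': "rg_from k t"
    if "rg_from (m + k) (map (lift_letter m) t)" "1 \<le> k" "\<forall>x\<in>set t. 1 \<le> x" for k t
    using that
  proof (induction t arbitrary: k)
    case (Cons x t)
    have "max (m + k) (lift_letter m x) = m + max k x"
      using Cons.prems by (auto simp: lift_letter_def)
    thus ?case
      using Cons by (auto simp: lift_letter_def split: if_splits)
  qed simp
  \<comment> \<open>The auxiliary fact \<open>rgv'\<close> needs \<open>1 \<le> k\<close>; the first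
    letter of \<open>v\<close> is 1, so the remainder starts with \<open>k = 1\<close>.\<close>
  have rgv: "rg_from 0 v"
  proof (cases v)
    case (Cons x t)
    hence "x = 1"
      using B1 v_def by auto
    thus ?thesis
      using rgB rgv'[of 1 t] v1 Cons by (auto simp: Bv lift_letter_def)
  qed simp
  have "subseq A w" "subseq B w"
    unfolding AB by (auto intro: list_emb_Cons subseq_rev_drop_many subseq_drop_many)
  hence "noncrossing A" "noncrossing B"
    using w(1) noncrossing_subseq by (auto simp: NCW_def)
  moreover have "strict_mono_on (set A) (\<lambda>x. x - 1)"
    using A2 by (fastforce simp: strict_mono_on_def)
  moreover have "strict_mono_on (set B) (\<lambda>x. if x = 1 then 1 else x - m)"
    using Bm NCW_pos[OF w(1)] by (fastforce simp: strict_mono_on_def AB)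
  ultimately have "noncrossing u" "noncrossing v"
    unfolding u_def v_def by (auto intro: noncrossing_map)
  hence "u \<in> NCW" "v \<in> NCW" "w = join (u, v)"
    using rgu rgv by (auto simp: NCW_def AB Au Bv join_def m_def)
  thus ?thesis by blast
qed

lemma bij_betw_join: "bij_betw join (NCW \<times> NCW) (NCW - {[]})"
  unfolding bij_betw_def
proof
  show "join ` (NCW \<times> NCW) = NCW - {[]}"
  proof (intro equalityI subsetI)
    fix w assume "w \<in> NCW - {[]}"
    thus "w \<in> join ` (NCW \<times> NCW)"
      using join_surj[of w] by auto
  qed (use join_NCW in auto)
qed (rule inj_on_join)


section \<open>Weighted generating functions\<close>

text \<open>A sum over an infinite fibre of \<open>len\<close> is 0, hence the finiteness
  assumptions in the product and filter rules below.\<close>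

definition weight_gf :: "('s \<Rightarrow> nat) \<Rightarrow> ('s \<Rightarrow> 'r) \<Rightarrow> 's set \<Rightarrow> 'r::comm_ring_1 fps" where
  "weight_gf len wt S = Abs_fps (\<lambda>n. \<Sum>s | s \<in> S \<and> len s = n. wt s)"

lemma weight_gf_bij:
  assumes "bij_betw f S T"
    and len: "\<And>s. s \<in> S \<Longrightarrow> len' (f s) = len s + k"
    and wt: "\<And>s. s \<in> S \<Longrightarrow> wt' (f s) = wt s"
  shows "weight_gf len' wt' T = fps_X ^ k * weight_gf len wt S"
proof (rule fps_ext)
  fix n
  have T: "T = f ` S" and inj: "inj_on f S"
    using assms(1) by (auto simp: bij_betw_def)
  show "weight_gf len' wt' T $ n = (fps_X ^ k * weight_gf len wt S) $ n"
  proof (cases "n < k")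
    case True
    hence "{t. t \<in> T \<and> len' t = n} = {}"
      using len by (auto simp: T)
    hence "(\<Sum>t | t \<in> T \<and> len' t = n. wt' t) = 0"
      by (simp only: sum.empty)
    thus ?thesis
      using True by (simp add: weight_gf_def fps_X_power_mult_nth)
  next
    case False
    hence "{t. t \<in> T \<and> len' t = n} = f ` {s. s \<in> S \<and> len s = n - k}"
      using len by (auto simp: T image_iff)
    moreover have "inj_on f {s. s \<in> S \<and> len s = n - k}"
      using inj by (rule inj_on_subset) auto
    ultimately have "(\<Sum>t | t \<in> T \<and> len' t = n. wt' t) = (\<Sum>s | s \<in> S \<and> len s = n - k. wt s)"
      using wt by (simp add: sum.reindex)
    thus ?thesis
      using False by (simp add: weight_gf_def fps_X_power_mult_nth)
  qed
qed

text \<open>Pairs of total length \<open>n\<close> are sorted by the length of the first component,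
  which gives the Cauchy product.\<close>

lemma weight_gf_times:
  assumes "\<And>n. finite {s \<in> S. len s = n}" "\<And>n. finite {t \<in> T. len' t = n}"
  shows "weight_gf (\<lambda>(s, t). len s + len' t) (\<lambda>(s, t). wt s * wt' t) (S \<times> T) =
    weight_gf len wt S * weight_gf len' wt' T"
proof (rule fps_ext)
  fix n
  define P where "P i = {s \<in> S. len s = i} \<times> {t \<in> T. len' t = n - i}" for i
  have "{p. p \<in> S \<times> T \<and> (case p of (s, t) \<Rightarrow> len s + len' t) = n} = (\<Union>i\<in>{0..n}. P i)"
    by (auto simp: P_def)
  moreover have "(\<Sum>p\<in>(\<Union>i\<in>{0..n}. P i). case p of (s, t) \<Rightarrow> wt s * wt' t) =
      (\<Sum>i = 0..n. \<Sum>p\<in>P i. case p of (s, t) \<Rightarrow> wt s * wt' t)"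
    by (rule sum.UNION_disjoint) (auto simp: P_def assms)
  ultimately show "weight_gf (\<lambda>(s, t). len s + len' t) (\<lambda>(s, t). wt s * wt' t) (S \<times> T) $ n =
      (weight_gf len wt S * weight_gf len' wt' T) $ n"
    by (simp add: weight_gf_def fps_mult_nth P_def sum_product sum.cartesian_product)
qed

lemma weight_gf_add:
  "weight_gf len (\<lambda>s. wt s + wt' s) S = weight_gf len wt S + weight_gf len wt' S"
  by (rule fps_ext) (simp add: weight_gf_def sum.distrib)

lemma weight_gf_cmult: "weight_gf len (\<lambda>s. c * wt s) S = fps_const c * weight_gf len wt S"
  by (rule fps_ext) (simp add: weight_gf_def sum_distrib_left)

lemma weight_gf_filter:
  assumes "\<And>n. finite {s \<in> S. len s = n}"
  shows "weight_gf len (\<lambda>s. if P s then wt s else 0) S = weight_gf len wt {s \<in> S. P s}"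
proof (rule fps_ext)
  fix n
  have "{s. s \<in> {s \<in> S. P s} \<and> len s = n} = {s \<in> {s \<in> S. len s = n}. P s}"
    by auto
  thus "weight_gf len (\<lambda>s. if P s then wt s else 0) S $ n = weight_gf len wt {s \<in> S. P s} $ n"
    using sum.inter_filter[OF assms[of n], of wt P] by (simp add: weight_gf_def)
qed

text \<open>All letters up to the maximum occur, so the maximum is at most the length.\<close>

lemma finite_NCW_length: "finite {w \<in> NCW. length w = n}"
proof (rule finite_subset)
  show "{w \<in> NCW. length w = n} \<subseteq> {w. set w \<subseteq> {1..n} \<and> length w = n}"
  proof (rule subsetI)
    fix w assume "w \<in> {w \<in> NCW. length w = n}"
    moreover from this have "set w = {1..letter_max w}"
      using NCW_set by blast
    moreover from this have "letter_max w \<le> length w"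
      using card_length[of w] by simp
    ultimately show "w \<in> {w. set w \<subseteq> {1..n} \<and> length w = n}"
      by auto
  qed
qed (simp add: finite_lists_length_eq)

section \<open>Occurrences of the pattern\<close>

lemma order_isomorphic_refl [simp]: "order_isomorphic u u"
  by (simp add: order_isomorphic_def)

lemma order_isomorphic_length: "order_isomorphic u v \<Longrightarrow> length u = length v"
  by (simp add: order_isomorphic_def)

lemma order_isomorphic_map_iff:
  assumes "strict_mono_on (set u) f"
  shows "order_isomorphic (map f u) v \<longleftrightarrow> order_isomorphic u v"
proof -
  have "f (u ! i) < f (u ! j) \<longleftrightarrow> u ! i < u ! j" "f (u ! i) = f (u ! j) \<longleftrightarrow> u ! i = u ! j"
    if "i < length u" "j < length u" for i j
    using that strict_mono_on_less[OF assms] strict_mono_on_eq[OF assms] by auto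
  thus ?thesis
    by (simp add: order_isomorphic_def)
qed

text \<open>Each letter of \<open>v\<close> is sent to the letter of \<open>u\<close> at a chosen
  position of it; the choice is immaterial since the equalities in both words agree.\<close>

lemma order_isomorphicE:
  assumes "order_isomorphic u v"
  obtains h where "strict_mono_on (set v) h" "u = map h v"
proof -
  have len: "length u = length v"
    and less: "\<And>i j. i < length v \<Longrightarrow> j < length v \<Longrightarrow> u ! i < u ! j \<longleftrightarrow> v ! i < v ! j"
    and eq: "\<And>i j. i < length v \<Longrightarrow> j < length v \<Longrightarrow> u ! i = u ! j \<longleftrightarrow> v ! i = v ! j"
    using assms by (auto simp: order_isomorphic_def)
  define pos where "pos x = (SOME i. i < length v \<and> v ! i = x)" for x
  have pos: "pos x < length v \<and> v ! pos x = x" if "x \<in> set v" for x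
    using that unfolding pos_def in_set_conv_nth by (rule someI_ex)
  define h where "h x = u ! pos x" for x
  have "strict_mono_on (set v) h"
    using pos less by (auto simp: strict_mono_on_def h_def)
  moreover have "u = map h v"
    using len pos eq by (intro nth_equalityI) (auto simp: h_def)
  ultimately show ?thesis
    using that by blast
qed

definition graft :: "nat \<Rightarrow> nat \<Rightarrow> nat \<Rightarrow> nat" where
  "graft d m x = (if x = 1 then d else m + (x - 1))"

lemma strict_mono_on_graft: "d \<le> m \<Longrightarrow> strict_mono_on {1..} (graft d m)"
  by (auto simp: strict_mono_on_def graft_def)

text \<open>Here \<open>Suc k\<close> is the maximum reached in the pattern and \<open>k\<close> the
  number of new letters used so far; they differ by one because the letter 1 takes no new
  letter.\<close>

lemma rg_from_map_graft:
  "1 \<le> d \<Longrightarrow> d \<le> m \<Longrightarrow> rg_from (Suc k) v \<Longrightarrow> rg_from (m + k) (map (graft d m) v)"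
proof (induction v arbitrary: k)
  case (Cons x v)
  have "max (Suc k) x = Suc (max k (x - 1))"
    using Cons.prems by auto
  moreover have "max (m + k) (graft d m x) = m + max k (x - 1)"
    using Cons.prems by (auto simp: graft_def)
  ultimately show ?case
    using Cons.IH[of "max k (x - 1)"] Cons.prems by (auto simp: graft_def)
qed simp

text \<open>A restricted growth continuation that only uses \<open>h 1\<close> and new letters
  has no choice: the new letters appear in increasing order without gaps.\<close>

lemma rg_from_map_eq_graft:
  assumes "rg_from (Suc k) v" "rg_from (m + k) (map h v)" "h 1 = d" "d \<le> m"
    and "\<forall>j\<in>{2..Suc k}. h j = m + (j - 1)" "\<forall>x\<in>set v. x \<noteq> 1 \<longrightarrow> m < h x"
    and "strict_mono_on ({1..Suc k} \<union> set v) h"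
  shows "map h v = map (graft d m) v"
  using assms
proof (induction v arbitrary: k)
  case (Cons x v)
  have x: "1 \<le> x" "x \<le> Suc (Suc k)"
    using Cons.prems(1) by auto
  show ?case
  proof (cases "x = Suc (Suc k)")
    case True
    \<comment> \<open>Monotonicity, or for \<open>k = 0\<close> the assumption on new letters, puts
      \<open>h x\<close> above \<open>m + k\<close>. The growth bound allows at most
      \<open>m + Suc k\<close>, so the value is forced.\<close>
    have "m + k < h x"
    proof (cases k)
      case 0
      thus ?thesis
        using Cons.prems(6) True by simp
    next
      case (Suc n)
      have "h (Suc k) < h x"
        using strict_mono_onD[OF Cons.prems(7), of "Suc k" x] True by simp
      thus ?thesis
        using Cons.prems(5) Suc by simp
    qed
    hence hx: "h x = m + Suc k"
      using Cons.prems(2) by simp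
    have "map h v = map (graft d m) v"
    proof (rule Cons.IH[of "Suc k"])
      show "rg_from (m + Suc k) (map h v)" "rg_from (Suc (Suc k)) v"
        using Cons.prems(1,2) hx True by (simp_all add: max_def)
      show "\<forall>j\<in>{2..Suc (Suc k)}. h j = m + (j - 1)"
        using Cons.prems(5) hx True by (auto simp: le_Suc_eq)
      show "strict_mono_on ({1..Suc (Suc k)} \<union> set v) h"
        using Cons.prems(7) by (rule monotone_on_subset) (auto simp: True le_Suc_eq)
    qed (use Cons.prems in auto)
    thus ?thesis
      using hx True by (simp add: graft_def)
  next
    case False
    have hx: "h x = graft d m x"
      using Cons.prems(3,5) x False by (cases "x = 1") (auto simp: graft_def)
    have "map h v = map (graft d m) v"
    proof (rule Cons.IH[of k])
      have "max (m + k) (h x) = m + k" "max (Suc k) x = Suc k"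
        using Cons.prems(4) x False by (auto simp: hx graft_def)
      thus "rg_from (m + k) (map h v)" "rg_from (Suc k) v"
        using Cons.prems(1,2) by simp_all
      show "strict_mono_on ({1..Suc k} \<union> set v) h"
        using Cons.prems(7) by (rule monotone_on_subset) auto
    qed (use Cons.prems in auto)
    thus ?thesis
      using hx by simp
  qed
qed simp

section \<open>Occurrences of \<open>\<tau>\<close> and monotone relabelling\<close>

locale nc_pattern =
  fixes a b :: nat and \<rho> :: "nat list"
  assumes a: "a \<ge> 1" and b: "b \<ge> 1" and \<rho>: "\<rho> \<in> NC a"
    and single: "b \<ge> 2 \<Longrightarrow> length (takeWhile (\<lambda>x. x = 1) \<rho>) = 1"
begin

abbreviation "\<tau> \<equiv> map Suc \<rho> @ replicate b 1"

lemma length_\<rho>: "length \<rho> = a" and \<rho>_NCW: "\<rho> \<in> NCW"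
  using \<rho> by (auto simp: NC_eq)

definition occ_at :: "nat list \<Rightarrow> nat \<Rightarrow> bool" where
  "occ_at w i \<longleftrightarrow> i + a + b \<le> length w \<and> order_isomorphic (take a (drop i w)) \<rho> \<and>
     (\<forall>k<b. w ! (i + a + k) = w ! (i + a)) \<and> (\<forall>k<a. w ! (i + a) < w ! (i + k))"

text \<open>The letters of \<open>map Suc \<rho>\<close> are at least 2, so the comparisons between
  the two parts of \<open>\<tau>\<close> reduce to the run being below the first \<open>a\<close>
  letters.\<close>

lemma order_isomorphic_\<tau>_iff:
  assumes "length u = a + b"
  shows "order_isomorphic u \<tau> \<longleftrightarrow> order_isomorphic (take a u) \<rho> \<and>
     (\<forall>k<b. u ! (a + k) = u ! a) \<and> (\<forall>k<a. u ! a < u ! k)"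
proof -
  define t where "t = \<tau>"
  have \<tau>1: "t ! i = Suc (\<rho> ! i)" if "i < a" for i
    using that by (simp add: t_def nth_append length_\<rho>)
  have \<tau>2: "t ! (a + k) = 1" if "k < b" for k
    using that by (simp add: t_def nth_append length_\<rho>)
  have pos: "1 \<le> \<rho> ! i" if "i < a" for i
    using NCW_pos[OF \<rho>_NCW] nth_mem[of i \<rho>] that length_\<rho> by auto
  show ?thesis
    unfolding t_def[symmetric]
  proof (intro iffI conjI allI impI)
    assume *: "order_isomorphic u t"
    have cmp: "u ! i < u ! j \<longleftrightarrow> t ! i < t ! j" "u ! i = u ! j \<longleftrightarrow> t ! i = t ! j"
      if "i < a + b" "j < a + b" for i j
      using * that assms unfolding order_isomorphic_def by auto
    show "order_isomorphic (take a u) \<rho>"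
      unfolding order_isomorphic_def
      using cmp by (auto simp: assms length_\<rho> \<tau>1)
    show "u ! (a + k) = u ! a" if "k < b" for k
      using cmp(2)[of "a + k" a] that \<tau>2[of k] \<tau>2[of 0] b by simp
    show "u ! a < u ! k" if "k < a" for k
      using cmp(1)[of a k] that \<tau>1[of k] \<tau>2[of 0] b pos[of k] by simp
  next
    assume *: "order_isomorphic (take a u) \<rho> \<and> (\<forall>k<b. u ! (a + k) = u ! a) \<and> (\<forall>k<a. u ! a < u ! k)"
    hence iso: "u ! i < u ! j \<longleftrightarrow> \<rho> ! i < \<rho> ! j" "u ! i = u ! j \<longleftrightarrow> \<rho> ! i = \<rho> ! j"
      if "i < a" "j < a" for i j
      using that by (auto simp: order_isomorphic_def assms length_\<rho>)
    have low: "u ! i = u ! a" if "a \<le> i" "i < a + b" for i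
      using * that by (metis add_less_cancel_left le_add_diff_inverse)
    have less: "u ! a < u ! k" if "k < a" for k
      using * that by blast
    have \<tau>2': "t ! i = 1" if "a \<le> i" "i < a + b" for i
      using \<tau>2[of "i - a"] that by simp
    show "order_isomorphic u t"
      unfolding order_isomorphic_def
    proof (intro conjI allI impI)
      fix i j assume ij: "i < length u" "j < length u"
      show "u ! i < u ! j \<longleftrightarrow> t ! i < t ! j" and "u ! i = u ! j \<longleftrightarrow> t ! i = t ! j"
        using ij iso[of i j] low[of i] low[of j] less[of i] less[of j] pos[of i] pos[of j] assms
          \<tau>1[of i] \<tau>1[of j] \<tau>2'[of i] \<tau>2'[of j]
        by (cases "i < a"; cases "j < a"; simp)+
    qed (simp add: assms t_def length_\<rho>)
  qed
qed

definition occs :: "nat list \<Rightarrow> nat" where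
  "occs w = card {i. occ_at w i}"

lemma occurrences_\<tau>: "occurrences \<tau> w = occs w"
proof -
  have "i + length \<tau> \<le> length w \<and> order_isomorphic (take (length \<tau>) (drop i w)) \<tau> \<longleftrightarrow> occ_at w i" for i
  proof (cases "i + a + b \<le> length w")
    case True
    thus ?thesis
      using order_isomorphic_\<tau>_iff[of "take (a + b) (drop i w)"] b
      by (simp add: occ_at_def length_\<rho> ac_simps)
  qed (simp add: occ_at_def length_\<rho>)
  thus ?thesis
    unfolding occurrences_def occs_def by simp
qed

lemma finite_occ_at: "finite {i. occ_at w i}"
  by (rule finite_subset[of _ "{..length w}"]) (auto simp: occ_at_def)

lemma occ_at_map_iff:
  assumes "strict_mono_on (set w) f"
  shows "occ_at (map f w) i \<longleftrightarrow> occ_at w i"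
proof (cases "i + a + b \<le> length w")
  case True
  have "strict_mono_on (set (take a (drop i w))) f"
    using assms by (rule monotone_on_subset) (meson order_trans set_drop_subset set_take_subset)
  hence "order_isomorphic (take a (drop i (map f w))) \<rho> \<longleftrightarrow> order_isomorphic (take a (drop i w)) \<rho>"
    by (simp add: order_isomorphic_map_iff take_map drop_map)
  moreover have "f (w ! i) < f (w ! j) \<longleftrightarrow> w ! i < w ! j" "f (w ! i) = f (w ! j) \<longleftrightarrow> w ! i = w ! j"
    if "i < length w" "j < length w" for i j
    using that strict_mono_on_less[OF assms] strict_mono_on_eq[OF assms] by auto
  ultimately show ?thesis
    using True b by (auto simp: occ_at_def)
qed (simp add: occ_at_def)

lemma occs_map:
  "strict_mono_on (set w) f \<Longrightarrow> occs (map f w) = occs w"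
  by (simp add: occs_def occ_at_map_iff)

text \<open>The run of an occurrence lies strictly below its first letter, which is impossible if
  that letter is the minimum 1.\<close>

lemma not_occ_at_Cons_1:
  assumes "\<forall>x\<in>set w. 1 \<le> x"
  shows "\<not> occ_at (1 # w) 0"
proof
  assume *: "occ_at (1 # w) 0"
  hence "(1 # w) ! a < 1" "a < length (1 # w)"
    using a b by (auto simp: occ_at_def)
  thus False
    using assms a nth_mem[of "a - 1" w] by (cases a) auto
qed

lemma occ_at_Cons_Suc: "occ_at (x # w) (Suc i) \<longleftrightarrow> occ_at w i"
  by (auto simp: occ_at_def)

lemma occs_Cons_1:
  assumes "\<forall>x\<in>set w. 1 \<le> x"
  shows "occs (1 # w) = occs w"
proof -
  have "{i. occ_at (1 # w) i} = Suc ` {i. occ_at w i}"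
  proof (intro equalityI subsetI)
    fix i assume "i \<in> {i. occ_at (1 # w) i}"
    thus "i \<in> Suc ` {i. occ_at w i}"
      using not_occ_at_Cons_1[OF assms] by (cases i) (auto simp: occ_at_Cons_Suc)
  qed (auto simp: occ_at_Cons_Suc)
  thus ?thesis
    by (simp add: occs_def card_image)
qed

section \<open>Occurrences across a junction\<close>

definition ends_in_\<rho> :: "nat list \<Rightarrow> bool" where
  "ends_in_\<rho> u \<longleftrightarrow> (\<exists>g v. u = g @ v \<and> order_isomorphic v \<rho>)"

definition starts_with_ones :: "nat list \<Rightarrow> bool" where
  "starts_with_ones v \<longleftrightarrow> b \<le> length v \<and> (\<forall>k<b. v ! k = 1)"

lemma ends_in_\<rho>_map_iff:
  assumes "strict_mono_on (set u) f"
  shows "ends_in_\<rho> (map f u) \<longleftrightarrow> ends_in_\<rho> u"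
proof -
  have "order_isomorphic (map f v) \<rho> \<longleftrightarrow> order_isomorphic v \<rho>" if "u = g @ v" for g v
    using assms that by (intro order_isomorphic_map_iff) (auto elim!: monotone_on_subset)
  thus ?thesis
    unfolding ends_in_\<rho>_def by (auto simp: map_eq_append_conv)
qed

lemma starts_with_ones_map_lift_letter:
  assumes "\<forall>x\<in>set v. 1 \<le> x"
  shows "starts_with_ones (map (lift_letter m) v) \<longleftrightarrow> starts_with_ones v"
proof -
  have "map (lift_letter m) v ! k = 1 \<longleftrightarrow> v ! k = 1" if "k < length v" for k
  proof -
    have "1 \<le> v ! k"
      using assms nth_mem[OF that] by blast
    thus ?thesis
      using that by (auto simp: lift_letter_def)
  qed
  thus ?thesis
    unfolding starts_with_ones_def length_map by (meson order.strict_trans2)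
qed

text \<open>The letter 1 at the junction is the minimum of the word, so an occurrence across the
  junction has to split there into its two parts.\<close>

lemma occ_at_append_straddle_iff:
  assumes A: "\<forall>x\<in>set A. 2 \<le> x" and B: "\<forall>x\<in>set B. 1 \<le> x" "B = [] \<or> hd B = 1"
    and i: "i < length A" "length A < i + a + b"
  shows "occ_at (A @ B) i \<longleftrightarrow> i + a = length A \<and> ends_in_\<rho> A \<and> starts_with_ones B"
proof
  assume occ: "occ_at (A @ B) i"
  define z where "z = (A @ B) ! (i + a)"
  have len: "i + a + b \<le> length A + length B"
    and iso: "order_isomorphic (take a (drop i (A @ B))) \<rho>"
    and eq: "\<And>k. k < b \<Longrightarrow> (A @ B) ! (i + a + k) = z"
    and less: "\<And>k. k < a \<Longrightarrow> z < (A @ B) ! (i + k)"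
    using occ by (auto simp: occ_at_def z_def)
  have "B \<noteq> []"
    using len i by auto
  hence B1: "(A @ B) ! length A = 1"
    using B(2) by (simp add: nth_append hd_conv_nth)
  have z: "1 \<le> z"
    using nth_mem[of "i + a" "A @ B"] A B(1) len b unfolding z_def by fastforce
  have "i + a \<le> length A"
  proof (rule ccontr)
    assume "\<not> i + a \<le> length A"
    hence "length A - i < a" "i + (length A - i) = length A"
      using i by auto
    thus False
      using less[of "length A - i"] B1 z by simp
  qed
  \<comment> \<open>The run covers position \<open>length A\<close>, which carries a 1.\<close>
  hence "z = 1"
    using eq[of "length A - (i + a)"] i B1 by simp
  have ia: "i + a = length A"
  proof (rule ccontr)
    assume "i + a \<noteq> length A"
    hence "z \<in> set A"
      using \<open>i + a \<le> length A\<close> by (simp add: z_def nth_append)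
    thus False
      using A \<open>z = 1\<close> by auto
  qed
  have "A = take i A @ take a (drop i (A @ B))"
    using ia by simp
  hence "ends_in_\<rho> A"
    unfolding ends_in_\<rho>_def using iso by blast
  moreover have "starts_with_ones B"
    using eq len ia \<open>z = 1\<close> by (auto simp: starts_with_ones_def nth_append)
  ultimately show "i + a = length A \<and> ends_in_\<rho> A \<and> starts_with_ones B"
    using ia by simp
next
  assume *: "i + a = length A \<and> ends_in_\<rho> A \<and> starts_with_ones B"
  then obtain g v where gv: "A = g @ v" "order_isomorphic v \<rho>"
    and ones: "b \<le> length B" "\<And>k. k < b \<Longrightarrow> B ! k = 1"
    unfolding ends_in_\<rho>_def starts_with_ones_def by blast
  have len: "length v = a" "length g = i"
    using * gv order_isomorphic_length length_\<rho> by auto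
  have "(A @ B) ! (i + a + k) = 1" if "k < b" for k
    using * that ones by (simp add: nth_append)
  moreover have "2 \<le> (A @ B) ! (i + k)" if "k < a" for k
    using * that A nth_mem[of "i + k" A] by (auto simp: nth_append)
  moreover have "take a (drop i (A @ B)) = v"
    using len gv by simp
  ultimately show "occ_at (A @ B) i"
    using * gv ones b by (fastforce simp: occ_at_def)
qed

text \<open>The windows lie inside \<open>A\<close>, inside \<open>B\<close>, or straddle the
  junction; among the last only the one starting at \<open>length A - a\<close> can be an
  occurrence.\<close>

lemma occs_append:
  assumes A: "\<forall>x\<in>set A. 2 \<le> x" and B: "\<forall>x\<in>set B. 1 \<le> x" "B = [] \<or> hd B = 1"
  shows "occs (A @ B) = occs A + occs B +
           (if ends_in_\<rho> A \<and> starts_with_ones B then 1 else 0)"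
proof -
  define S where "S = (if ends_in_\<rho> A \<and> starts_with_ones B then {length A - a} else {})"
  have atA: "occ_at (A @ B) i \<longleftrightarrow> occ_at A i" if "i + a + b \<le> length A" for i
    using that b by (auto simp: occ_at_def nth_append)
  have atB: "occ_at (A @ B) i \<longleftrightarrow> occ_at B (i - length A)" if "length A \<le> i" for i
    using that by (auto simp: occ_at_def nth_append diff_add_assoc2 algebra_simps)
  have aA: "a \<le> length A" if "ends_in_\<rho> A"
    using that order_isomorphic_length length_\<rho> unfolding ends_in_\<rho>_def by fastforce
  have eq: "{i. occ_at (A @ B) i} = {i. occ_at A i} \<union> (\<lambda>i. i + length A) ` {i. occ_at B i} \<union> S"
  proof (rule set_eqI)
    fix i
    have shift: "i \<in> (\<lambda>i. i + length A) ` {i. occ_at B i} \<longleftrightarrow> length A \<le> i \<and> occ_at B (i - length A)"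
      by (auto simp: image_iff intro: exI[of _ "i - length A"])
    have S: "i \<in> S \<longleftrightarrow> i + a = length A \<and> ends_in_\<rho> A \<and> starts_with_ones B"
      using aA by (auto simp: S_def)
    have A_len: "occ_at A i \<Longrightarrow> i + a + b \<le> length A"
      by (simp add: occ_at_def)
    consider "i + a + b \<le> length A" | "length A \<le> i" | "i < length A" "length A < i + a + b"
      by linarith
    thus "i \<in> {i. occ_at (A @ B) i} \<longleftrightarrow> i \<in> {i. occ_at A i} \<union> (\<lambda>i. i + length A) ` {i. occ_at B i} \<union> S"
    proof cases
      case 1
      thus ?thesis
        using atA[of i] shift S a b by auto
    next
      case 2
      thus ?thesis
        using atB[of i] shift S A_len a b by auto
    next
      case 3
      thus ?thesis
        using occ_at_append_straddle_iff[OF A B 3] shift S A_len by auto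
    qed
  qed
  have "card {i. occ_at (A @ B) i} = card {i. occ_at A i} + card {i. occ_at B i} + card S"
    unfolding eq
  proof (subst card_Un_disjoint)
    show "card ({i. occ_at A i} \<union> (\<lambda>i. i + length A) ` {i. occ_at B i}) + card S =
        card {i. occ_at A i} + card {i. occ_at B i} + card S"
      using a by (subst card_Un_disjoint) (auto simp: finite_occ_at card_image, auto simp: occ_at_def)
    show "({i. occ_at A i} \<union> (\<lambda>i. i + length A) ` {i. occ_at B i}) \<inter> S = {}"
      using aA a b by (auto simp: S_def occ_at_def)
  qed (auto simp: finite_occ_at S_def)
  thus ?thesis
    by (simp add: occs_def S_def)
qed

text \<open>The leading 1 starts no occurrence, both relabellings are strictly increasing on the
  letters concerned, and the letters of \<open>map Suc u\<close> exceed 1, so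
  \<open>occs_append\<close> applies at the junction.\<close>

lemma occs_join:
  assumes u: "u \<in> NCW" and v: "v \<in> NCW"
  shows "occs (join (u, v)) = occs u + occs v +
           (if ends_in_\<rho> u \<and> starts_with_ones v then 1 else 0)"
proof -
  define f where "f = lift_letter (letter_max u)"
  have mono: "strict_mono_on (set u) Suc" "strict_mono_on (set v) f"
    using NCW_pos[OF v] unfolding f_def
    by (simp add: strict_mono_on_def, intro monotone_on_subset[OF strict_mono_on_lift_letter]) auto
  have A: "\<forall>x\<in>set (map Suc u). 2 \<le> x"
    using NCW_pos[OF u] by fastforce
  have B: "\<forall>x\<in>set (map f v). 1 \<le> x" "map f v = [] \<or> hd (map f v) = 1"
    using NCW_pos[OF v] NCW_Cons v by (cases v; force simp: f_def lift_letter_def)+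
  have "occs (join (u, v)) = occs (map Suc u @ map f v)"
    unfolding join_def prod.case append_Cons f_def[symmetric]
    by (rule occs_Cons_1) (use A B(1) in fastforce)
  also have "\<dots> = occs u + occs v +
      (if ends_in_\<rho> u \<and> starts_with_ones v then 1 else 0)"
    using occs_append[OF A B] mono NCW_pos[OF v]
    by (simp add: occs_map ends_in_\<rho>_map_iff starts_with_ones_map_lift_letter f_def)
  finally show ?thesis .
qed


section \<open>Extending the last letter to a copy of \<open>\<rho>\<close>\<close>

definition extend :: "nat list \<Rightarrow> nat list" where
  "extend w = w @ map (graft (last w) (letter_max w)) (tl \<rho>)"

lemma \<rho>_Cons: "\<rho> = 1 # tl \<rho>"
  using \<rho>_NCW length_\<rho> a NCW_Cons by (cases \<rho>) auto

lemma rg_tl_\<rho>: "rg_from 1 (tl \<rho>)"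
proof -
  have "rg_from 0 (1 # tl \<rho>)"
    using \<rho>_NCW \<rho>_Cons by (simp add: NCW_def)
  thus ?thesis by simp
qed

lemma tl_\<rho>_pos: "x \<in> set (tl \<rho>) \<Longrightarrow> 1 \<le> x"
  using NCW_pos[OF \<rho>_NCW] \<rho>_Cons by (metis list.set_intros(2))

lemma last_le_letter_max:
  assumes "w \<in> NCW" "w \<noteq> []"
  shows "1 \<le> last w" "last w \<le> letter_max w"
  using NCW_set[OF assms(1)] last_in_set[OF assms(2)] by auto

text \<open>The appended part consists of copies of \<open>last w\<close> and letters above
  \<open>m\<close>. If \<open>y > m\<close>, then \<open>y x y\<close> lies in it and pulls back to
  \<open>\<rho>\<close>. Otherwise it contributes at most the final \<open>y = last w\<close>, and
  the last letter of \<open>w\<close> can replace that one.\<close>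

lemma extend_noncrossing:
  assumes w: "w \<in> NCW" "w \<noteq> []"
  shows "noncrossing (extend w)"
proof -
  define m where "m = letter_max w"
  define f where "f = graft (last w) m"
  define T where "T = map f (tl \<rho>)"
  have e: "extend w = w @ T"
    by (simp add: extend_def T_def f_def m_def)
  have lm: "1 \<le> last w" "last w \<le> m"
    using last_le_letter_max[OF w] by (auto simp: m_def)
  have wm: "set w = {1..m}"
    using NCW_set[OF w(1)] by (simp add: m_def)
  have T: "x = last w \<or> m < x" if "x \<in> set T" for x
    using that tl_\<rho>_pos by (fastforce simp: T_def f_def graft_def)
  have mono: "strict_mono_on {1..} f"
    using strict_mono_on_graft lm by (simp add: f_def)
  have "False" if xy: "x < y" "subseq [x, y, x, y] (w @ T)" for x y
  proof (cases "m < y")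
    case True
    hence y: "y \<notin> set w"
      using wm by auto
    have "subseq [y, x, y] (w @ T)"
      using xy(2) by (rule subseq_Cons')
    then obtain p s where ps: "[y, x, y] = p @ s" "subseq p w" "subseq s T"
      using subseq_append_iff by metis
    have "p = []"
    proof (rule ccontr)
      assume "p \<noteq> []"
      hence "hd p = y"
        using ps(1) by (metis hd_append2 list.sel(1))
      thus False
        using y subseq_set_subset[OF ps(2)] hd_in_set[OF \<open>p \<noteq> []\<close>] by auto
    qed
    hence "subseq [y, x, y] (map f (tl \<rho>))"
      using ps T_def by simp
    then obtain zs where zs: "[y, x, y] = map f zs" "subseq zs (tl \<rho>)"
      by (rule subseq_map_inj)
    then obtain y1 x1 y2 where z: "zs = [y1, x1, y2]" "f y1 = y" "f x1 = x" "f y2 = y"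
      by (auto simp: map_eq_Cons_conv Cons_eq_map_conv)
    have pos: "1 \<le> y1" "1 \<le> x1" "1 \<le> y2"
      using subseq_set_subset[OF zs(2)] tl_\<rho>_pos z(1) by auto
    have "y1 = y2"
      using strict_mono_on_eqD[OF mono, of y2 y1] z(2,4) pos by simp
    moreover have "x1 < y1"
      using strict_mono_on_less[OF mono, of x1 y1] z(2,3) pos xy(1) by simp
    moreover have "subseq zs \<rho>"
      using zs(2) \<rho>_Cons by (metis list_emb_Cons)
    ultimately have "subseq [x1, y1, x1, y1] \<rho>"
      using subseq_rg_letter_before[of \<rho> x1 y1 "[x1, y1]"] z(1) \<rho>_NCW pos
      by (auto simp: NCW_def)
    thus False
      using NCW_no_crossing[OF \<rho>_NCW, of x1 y1] \<open>x1 < y1\<close> by simp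
  next
    case False
    have last: "z = last w" if "z \<in> {x, y}" "z \<in> set T" for z
      using T[OF that(2)] that(1) False xy(1) by auto
    from xy(2) obtain p s where ps: "[x, y, x, y] = p @ s" "subseq p w" "subseq s T"
      using subseq_append_iff by metis
    have sT: "\<forall>z\<in>set s. z = last w"
    proof
      fix z assume "z \<in> set s"
      moreover have "set s \<subseteq> {x, y}"
        using arg_cong[OF ps(1), of set] by auto
      ultimately show "z = last w"
        using last subseq_set_subset[OF ps(3)] by blast
    qed
    have "\<not> (x \<in> set s \<and> y \<in> set s)"
      using sT xy(1) by (metis less_irrefl)
    hence "s = [] \<or> s = [y]"
      using ps(1) by (auto simp: Cons_eq_append_conv append_eq_Cons_conv)
    hence "subseq [x, y, x, y] w"
    proof
      assume "s = []"
      thus ?thesis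
        using ps by simp
    next
      assume s: "s = [y]"
      hence "p = [x, y, x]" "last w = y"
        using ps(1) sT by auto
      hence sub: "subseq [x, y, x] (butlast w @ [y])"
        using ps(2) w(2) by (metis append_butlast_last_id)
      then obtain p' s' where p's': "[x, y, x] = p' @ s'" "subseq p' (butlast w)" "subseq s' [y]"
        using subseq_append_iff by metis
      have "s' = []"
      proof (rule ccontr)
        assume "s' \<noteq> []"
        hence "last s' = x"
          using p's'(1) by (metis last.simps last_appendR list.distinct(1))
        thus False
          using subseq_set_subset[OF p's'(3)] last_in_set[OF \<open>s' \<noteq> []\<close>] xy(1) by auto
      qed
      hence "subseq [x, y, x] (butlast w)"
        using p's' by simp
      hence "subseq ([x, y, x] @ [y]) (butlast w @ [y])"
        by (intro list_emb_append_mono) auto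
      thus ?thesis
        using \<open>last w = y\<close> w(2) by (metis append_butlast_last_id append_Cons append_Nil)
    qed
    thus False
      using NCW_no_crossing[OF w(1)] xy(1) by simp
  qed
  thus ?thesis
    unfolding e noncrossing_iff_subseq by blast
qed

lemma extend_eq_butlast: "w \<noteq> [] \<Longrightarrow> extend w = butlast w @ map (graft (last w) (letter_max w)) \<rho>"
  by (subst (2) \<rho>_Cons) (simp add: extend_def graft_def)

lemma extend_NCW:
  assumes w: "w \<in> NCW" "w \<noteq> []"
  shows "extend w \<in> NCW" "ends_in_\<rho> (extend w)"
proof -
  have "rg_from 0 (extend w)"
    using w last_le_letter_max[OF w] rg_tl_\<rho> rg_from_map_graft[of "last w" "letter_max w" 0]
    by (simp add: extend_def rg_from_append NCW_def)
  thus "extend w \<in> NCW"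
    using extend_noncrossing[OF w] by (simp add: NCW_def)
  have "order_isomorphic (map (graft (last w) (letter_max w)) \<rho>) \<rho>"
    using NCW_pos[OF \<rho>_NCW] last_le_letter_max[OF w]
    by (subst order_isomorphic_map_iff)
      (auto intro!: monotone_on_subset[OF strict_mono_on_graft])
  thus "ends_in_\<rho> (extend w)"
    unfolding ends_in_\<rho>_def extend_eq_butlast[OF w(2)] by blast
qed

text \<open>The word \<open>u\<close> ends with the first letter \<open>h 1\<close> of the final
  copy of \<open>\<rho>\<close>. If a larger letter \<open>h x\<close> of the copy occurred in
  \<open>g\<close>, restricted growth would put an \<open>h 1\<close> before it, and the copy would
  complete a crossing. So these letters are new, and \<open>rg_from_map_eq_graft\<close> determines
  them.\<close>

lemma ends_in_\<rho>_imp_extend: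
  assumes w: "w \<in> NCW" "ends_in_\<rho> w"
  shows "\<exists>u\<in>NCW - {[]}. w = extend u"
proof -
  obtain g v where gv: "w = g @ v" "order_isomorphic v \<rho>"
    using w(2) by (auto simp: ends_in_\<rho>_def)
  obtain h where h: "strict_mono_on (set \<rho>) h" "v = map h \<rho>"
    using gv(2) by (rule order_isomorphicE)
  define u where "u = g @ [h 1]"
  define m where "m = letter_max u"
  have wu: "w = u @ map h (tl \<rho>)"
    using gv h(2) \<rho>_Cons by (simp add: u_def) (metis list.simps(9))
  have rg: "rg_from 0 u" "rg_from m (map h (tl \<rho>))" and "noncrossing w"
    using w(1) by (auto simp: NCW_def wu rg_from_append m_def)
  have "noncrossing u"
    using \<open>noncrossing w\<close> noncrossing_subseq[of w u] by (simp add: wu subseq_rev_drop_many)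
  hence u: "u \<in> NCW" "u \<noteq> []"
    using rg(1) by (auto simp: NCW_def u_def)
  have um: "set u = {1..m}"
    using NCW_set[OF u(1)] by (simp add: m_def)
  have set\<rho>: "set \<rho> = insert 1 (set (tl \<rho>))"
    by (subst \<rho>_Cons) simp
  have new: "m < h x" if x: "x \<in> set (tl \<rho>)" "x \<noteq> 1" for x
  proof (rule ccontr)
    assume "\<not> m < h x"
    have "1 \<le> h x"
      using NCW_pos[OF w(1), of "h x"] x(1) wu by simp
    hence "h x \<in> set u"
      using um \<open>\<not> m < h x\<close> by auto
    have less: "h 1 < h x"
      using strict_mono_onD[OF h(1), of 1 x] set\<rho> x tl_\<rho>_pos[OF x(1)] by auto
    hence "h x \<in> set g"
      using \<open>h x \<in> set u\<close> by (auto simp: u_def)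
    hence "subseq [h x] g"
      by (simp add: subseq_singleton_left)
    moreover have "rg_from 0 g"
      using rg(1) by (simp add: u_def rg_from_append)
    moreover have "1 \<le> h 1"
      using NCW_pos[OF u(1), of "h 1"] by (simp add: u_def)
    ultimately have "subseq [h 1, h x] g"
      using subseq_rg_letter_before[of g "h 1" "h x" "[]"] less by simp
    moreover have "subseq [h 1, h x] v"
      using x(1) unfolding h(2) by (subst \<rho>_Cons) (simp add: subseq_singleton_left)
    ultimately have "subseq ([h 1, h x] @ [h 1, h x]) w"
      unfolding gv(1) by (rule list_emb_append_mono)
    thus False
      using NCW_no_crossing[OF w(1), of "h 1" "h x"] less by simp
  qed
  have "map h (tl \<rho>) = map (graft (h 1) m) (tl \<rho>)"
  \<comment> \<open>With parameter 0, only the letter 1 of \<open>\<rho>\<close>, represented by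
    \<open>h 1\<close>, has been used so far.\<close>
  proof (rule rg_from_map_eq_graft[of 0])
    show "h 1 \<le> m"
      using um by (auto simp: u_def)
    show "strict_mono_on ({1..Suc 0} \<union> set (tl \<rho>)) h"
      using h(1) set\<rho> by simp
  qed (use rg rg_tl_\<rho> new in auto)
  hence "w = extend u"
    by (simp add: wu extend_def m_def) (simp add: u_def)
  thus ?thesis
    using u by auto
qed

lemma bij_betw_extend: "bij_betw extend (NCW - {[]}) {w \<in> NCW. ends_in_\<rho> w}"
  unfolding bij_betw_def
proof
  \<comment> \<open>The appended part has \<open>a - 1\<close> letters whatever the word is, so
    equal extensions have equal initial parts.\<close>
  show "inj_on extend (NCW - {[]})"
    by (auto simp: inj_on_def extend_def)
  show "extend ` (NCW - {[]}) = {w \<in> NCW. ends_in_\<rho> w}"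
  proof (intro equalityI subsetI)
    fix w assume "w \<in> {w \<in> NCW. ends_in_\<rho> w}"
    thus "w \<in> extend ` (NCW - {[]})"
      using ends_in_\<rho>_imp_extend[of w] by auto
  qed (use extend_NCW in auto)
qed

text \<open>An occurrence ending in the new part would be too long to lie in the final copy of \<open>\<rho>\<close>.
  Hence it contains letters of \<open>w\<close>, so its run of equal minimal letters consists of copies of
  \<open>last w\<close> and starts with \<open>last w\<close> itself, whereas \<open>\<rho>\<close> starts with a single 1.\<close>

lemma occs_extend:
  assumes w: "w \<in> NCW" "w \<noteq> []"
  shows "occs (extend w) = occs w"
proof -
  define m where "m = letter_max w"
  define T where "T = map (graft (last w) m) (tl \<rho>)"
  have e: "extend w = w @ T"
    by (simp add: extend_def T_def m_def)
  have lenT: "length T = a - 1"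
    by (simp add: T_def length_\<rho>)
  have wm: "set w = {1..m}"
    using NCW_set[OF w(1)] by (simp add: m_def)
  have T: "x = last w \<or> m < x" if "x \<in> set T" for x
    using that tl_\<rho>_pos by (fastforce simp: T_def graft_def)
  have "occ_at (w @ T) i \<longleftrightarrow> occ_at w i" for i
  proof (cases "i + a + b \<le> length w")
    case True
    thus ?thesis
      using b by (auto simp: occ_at_def nth_append)
  next
    case False
    have "\<not> occ_at (w @ T) i"
    proof
      assume occ: "occ_at (w @ T) i"
      define z where "z = (w @ T) ! (i + a)"
      have len: "i + a + b \<le> length w + (a - 1)"
        and eq: "\<And>k. k < b \<Longrightarrow> (w @ T) ! (i + a + k) = z"
        and less: "\<And>k. k < a \<Longrightarrow> z < (w @ T) ! (i + k)"
        using occ by (auto simp: occ_at_def z_def lenT)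
      \<comment> \<open>The window has \<open>a + b\<close> letters but \<open>T\<close> only
        \<open>a - 1\<close>, so at least \<open>b + 1\<close> letters of the window lie in
        \<open>w\<close>.\<close>
      have i: "i + b \<le> length w - 1"
        using len a by linarith
      have "z = (w @ T) ! (i + a + b - 1)"
        using eq[of "b - 1"] b by simp
      also have "\<dots> = T ! (i + a + b - 1 - length w)"
        using False a b by (auto simp: nth_append)
      also have "\<dots> \<in> set T"
        using False len a b by (intro nth_mem) (simp add: lenT)
      finally have zT: "z \<in> set T" .
      have "i < length w"
        using i b w(2) by (cases w) auto
      hence "(w @ T) ! i \<in> set w"
        by (simp add: nth_append)
      hence "z < m"
        using less[of 0] a wm by auto
      hence z: "z = last w"
        using T[OF zT] by simp
      have wl: "(w @ T) ! (length w - 1) = z"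
        using w(2) z by (simp add: nth_append last_conv_nth)
      \<comment> \<open>The first \<open>a\<close> letters of the window exceed \<open>z\<close>, so
        the last letter of \<open>w\<close>, being \<open>z\<close>, must belong to the run.\<close>
      have "i + a \<le> length w - 1"
      proof (rule ccontr)
        assume "\<not> i + a \<le> length w - 1"
        hence "length w - 1 - i < a" "i + (length w - 1 - i) = length w - 1"
          using i by auto
        thus False
          using less[of "length w - 1 - i"] wl by simp
      qed
      \<comment> \<open>Hence the run also reaches the first letter of \<open>T\<close>, which is
        only possible for \<open>b \<ge> 2\<close>.\<close>
      hence k: "length w - (i + a) < b" "i + a + (length w - (i + a)) = length w" "1 \<le> length w - (i + a)"
        using False \<open>i < length w\<close> by linarith+
      hence "(w @ T) ! length w = z" "b \<ge> 2"
        using eq[of "length w - (i + a)"] by auto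
      moreover have "T \<noteq> []"
        using zT by auto
      ultimately have "hd T = last w"
        using z by (simp add: nth_append hd_conv_nth)
      moreover have ne: "tl \<rho> \<noteq> []"
        using \<open>T \<noteq> []\<close> by (auto simp: T_def)
      ultimately have "graft (last w) m (hd (tl \<rho>)) = last w"
        by (simp add: T_def hd_map)
      hence "hd (tl \<rho>) = 1"
        using last_le_letter_max[OF w] tl_\<rho>_pos[OF hd_in_set[OF ne]]
        by (auto simp: graft_def m_def split: if_splits)
      hence "\<rho> = 1 # 1 # tl (tl \<rho>)"
        using \<rho>_Cons ne by (metis list.collapse)
      hence "length (takeWhile (\<lambda>x. x = 1) \<rho>) \<noteq> 1"
        by (rule ssubst) simp
      thus False
        using single \<open>b \<ge> 2\<close> by simp
    qed
    thus ?thesis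
      using False by (simp add: occ_at_def)
  qed
  thus ?thesis
    by (simp add: e occs_def)
qed

section \<open>Prepending ones\<close>

definition pad :: "nat list \<Rightarrow> nat list" where
  "pad w = replicate (b - 1) 1 @ w"

text \<open>A subsequence \<open>x y x y\<close> with \<open>x \<noteq> y\<close> uses at most one
  of two adjacent equal letters.\<close>

lemma NCW_Cons_1_iff: "1 # 1 # w \<in> NCW \<longleftrightarrow> 1 # w \<in> NCW"
proof -
  have "subseq [x, y, x, y] (1 # 1 # w) \<longleftrightarrow> subseq [x, y, x, y] (1 # w)" if "x \<noteq> y" for x y
    using that by (cases "x = 1") (auto simp: subseq_Cons2_iff)
  thus ?thesis
    by (auto simp: NCW_def noncrossing_iff_subseq)
qed

lemma replicate_NCW_iff: "replicate k 1 @ 1 # w \<in> NCW \<longleftrightarrow> 1 # w \<in> NCW"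
proof (induction k)
  case (Suc k)
  have "replicate (Suc k) 1 @ 1 # w = 1 # 1 # replicate k 1 @ w"
    by (simp add: replicate_app_Cons_same)
  moreover have "1 # replicate k 1 @ w = replicate k 1 @ 1 # w"
    by (simp add: replicate_app_Cons_same)
  ultimately show ?case
    using Suc NCW_Cons_1_iff by metis
qed simp

text \<open>A nonempty word in \<open>NCW\<close> already starts with 1, so \<open>b - 1\<close>
  further ones produce exactly the words that start with \<open>b\<close> ones.\<close>

lemma bij_betw_pad: "bij_betw pad (NCW - {[]}) {w \<in> NCW. starts_with_ones w}"
  unfolding bij_betw_def
proof
  show "inj_on pad (NCW - {[]})"
    by (auto simp: inj_on_def pad_def)
  show "pad ` (NCW - {[]}) = {w \<in> NCW. starts_with_ones w}"
  proof (intro equalityI subsetI)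
    fix w assume "w \<in> pad ` (NCW - {[]})"
    then obtain u where u: "u \<in> NCW" "u \<noteq> []" "w = pad u"
      by auto
    then obtain t where t: "u = 1 # t"
      using NCW_Cons by (cases u) auto
    have "w = replicate (b - 1) 1 @ 1 # t"
      using u t by (simp add: pad_def)
    moreover from this have "starts_with_ones w"
      by (auto simp: starts_with_ones_def nth_append nth_Cons')
    ultimately show "w \<in> {w \<in> NCW. starts_with_ones w}"
      using replicate_NCW_iff u t by auto
  next
    fix w assume w: "w \<in> {w \<in> NCW. starts_with_ones w}"
    define t where "t = drop b w"
    have "take b w = replicate b 1"
      using w by (intro nth_equalityI) (auto simp: starts_with_ones_def)
    hence "w = replicate b 1 @ t"
      unfolding t_def by (metis append_take_drop_id)
    also have "replicate b (1::nat) = replicate (b - 1) 1 @ [1]"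
      using b by (metis Suc_diff_1 replicate_Suc replicate_append_same less_le_trans zero_less_one)
    finally have "w = replicate (b - 1) 1 @ 1 # t"
      by simp
    hence "w = pad (1 # t)" "1 # t \<in> NCW"
      using w replicate_NCW_iff by (auto simp: pad_def)
    thus "w \<in> pad ` (NCW - {[]})"
      by auto
  qed
qed

lemma occs_pad:
  assumes "w \<in> NCW"
  shows "occs (pad w) = occs w"
proof -
  have "occs (replicate k 1 @ w) = occs w" for k
  proof (induction k)
    case (Suc k)
    have "occs (1 # (replicate k 1 @ w)) = occs (replicate k 1 @ w)"
      by (rule occs_Cons_1) (use NCW_pos[OF assms] in auto)
    thus ?case
      using Suc by simp
  qed simp
  thus ?thesis
    by (simp add: pad_def)
qed


section \<open>The quadratic equation of the generating function\<close>

lemma weight_gf_NCW_eq: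
  fixes q :: "'r::comm_ring_1"
  defines "F \<equiv> weight_gf length (\<lambda>w. q ^ occs w) NCW"
  shows "F - 1 = fps_X * F ^ 2 + fps_const (q - 1) * fps_X ^ (a + b - 1) * (F - 1) ^ 2"
proof -
  define wt where "wt = (\<lambda>w. q ^ occs w)"
  define G where "G = weight_gf length wt (NCW - {[]})"
  define A where "A w = (if ends_in_\<rho> w then wt w else 0)" for w
  define B where "B w = (if starts_with_ones w then wt w else 0)" for w
  have F: "F = weight_gf length wt NCW"
    by (simp add: F_def wt_def)
  have "occs [] = 0"
    using a by (simp add: occs_def occ_at_def)
  \<comment> \<open>The empty word has weight 1 and is the only one of length 0.\<close>
  have "F - 1 = G"
  proof (rule fps_ext)
    fix n
    show "(F - 1) $ n = G $ n"
    proof (cases "n = 0")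
      case True
      have "{w. w \<in> NCW \<and> length w = 0} = {[]}" "{w. w \<in> NCW - {[]} \<and> length w = 0} = {}"
        by auto
      thus ?thesis
        using \<open>occs [] = 0\<close> unfolding True F G_def weight_gf_def fps_sub_nth fps_nth_Abs_fps
        by (simp only: sum.empty) (simp add: wt_def)
    next
      case False
      hence "{w. w \<in> NCW - {[]} \<and> length w = n} = {w. w \<in> NCW \<and> length w = n}"
        by auto
      thus ?thesis
        using False by (simp add: F G_def weight_gf_def)
    qed
  qed
  \<comment> \<open>Since \<open>q ^ (n + 1) = q ^ n + (q - 1) * q ^ n\<close>, the additional
    occurrence is accounted for by a correction term that is again a product over \<open>u\<close>
    and \<open>v\<close>.\<close>
  have wt_join: "wt (join p) = (case p of (u, v) \<Rightarrow> wt u * wt v) +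
      (q - 1) * (case p of (u, v) \<Rightarrow> A u * B v)" if "p \<in> NCW \<times> NCW" for p
    using that by (auto simp: wt_def A_def B_def occs_join power_add algebra_simps)
  have "weight_gf length A NCW = weight_gf length wt {w \<in> NCW. ends_in_\<rho> w}"
    unfolding A_def by (rule weight_gf_filter) (rule finite_NCW_length)
  also have "\<dots> = fps_X ^ (a - 1) * G"
    unfolding G_def using bij_betw_extend
    by (rule weight_gf_bij) (auto simp: wt_def occs_extend, simp add: extend_def length_\<rho>)
  finally have gfA: "weight_gf length A NCW = fps_X ^ (a - 1) * G" .
  have "weight_gf length B NCW = weight_gf length wt {w \<in> NCW. starts_with_ones w}"
    unfolding B_def by (rule weight_gf_filter) (rule finite_NCW_length)
  also have "\<dots> = fps_X ^ (b - 1) * G"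
    unfolding G_def using bij_betw_pad
    by (rule weight_gf_bij) (auto simp: wt_def occs_pad, simp add: pad_def)
  finally have gfB: "weight_gf length B NCW = fps_X ^ (b - 1) * G" .
  have "G = fps_X ^ 1 * weight_gf (\<lambda>(u, v). length u + length v)
      (\<lambda>p. (case p of (u, v) \<Rightarrow> wt u * wt v) + (q - 1) * (case p of (u, v) \<Rightarrow> A u * B v))
      (NCW \<times> NCW)"
    unfolding G_def using bij_betw_join
    by (rule weight_gf_bij) (auto simp: wt_join, auto simp: join_def)
  also have "\<dots> = fps_X * (F * F + fps_const (q - 1) * (fps_X ^ (a - 1) * G * (fps_X ^ (b - 1) * G)))"
    by (simp add: weight_gf_add weight_gf_cmult weight_gf_times finite_NCW_length F gfA gfB)
  also have "\<dots> = fps_X * F ^ 2 + fps_const (q - 1) * (fps_X * fps_X ^ (a - 1) * fps_X ^ (b - 1)) * G ^ 2"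
    by (simp add: algebra_simps power2_eq_square)
  \<comment> \<open>The subtractions are exact because \<open>a\<close> and \<open>b\<close> are
    positive.\<close>
  also have "fps_X * fps_X ^ (a - 1) * fps_X ^ (b - 1) = (fps_X ^ (a + b - 1) :: 'r fps)"
    using a b by (simp flip: power_Suc power_add)
  finally show ?thesis
    by (simp add: \<open>F - 1 = G\<close>)
qed

end

section \<open>Solving the quadratic equation\<close>

theorem theorem4:
  fixes a b :: nat and \<rho> :: "nat list"
  assumes "a \<ge> 1" and "b \<ge> 1"
    and "\<rho> \<in> NC a"
    and "b \<ge> 2 \<Longrightarrow> length (takeWhile (\<lambda>x. x = 1) \<rho>) = 1"
  shows "Abs_fps (\<lambda>n. \<Sum>\<pi>\<in>NC n. qvar ^ occurrences (map Suc \<rho> @ replicate b 1) \<pi>) =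
    (1 + 2 * fps_const (qvar - 1) * fps_X ^ (a + b - 1)
       - fps_sqrt (1 - 4 * fps_X - 4 * fps_const (qvar - 1) * fps_X ^ (a + b)))
    / (2 * fps_X * (1 + fps_const (qvar - 1) * fps_X ^ (a + b - 2)))"
proof -
  interpret nc_pattern a b \<rho>
    using assms by unfold_locales
  define F where "F = weight_gf length (\<lambda>w. qvar ^ occs w) NCW"
  define C where "C = fps_const (qvar - 1)"
  define P :: "rat poly fract fps" where "P = fps_X ^ (a + b - 2)"
  define D where "D = 1 - 4 * fps_X - 4 * C * fps_X ^ (a + b)"
  \<comment> \<open>This is what the square root in the quadratic formula has to be.\<close>
  define R where "R = 1 + 2 * C * fps_X ^ (a + b - 1) - 2 * fps_X * (1 + C * P) * F"
  have XP: "fps_X ^ (a + b - 1) = fps_X * P" "fps_X ^ (a + b) = fps_X * fps_X * P"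
    unfolding P_def using assms(1,2) by (simp_all flip: power_Suc add: mult.assoc)
  have F: "Abs_fps (\<lambda>n. \<Sum>\<pi>\<in>NC n. qvar ^ occurrences \<tau> \<pi>) = F"
    unfolding F_def weight_gf_def NC_eq occurrences_\<tau> ..
  have "F - 1 = fps_X * F ^ 2 + C * (fps_X * P) * (F - 1) ^ 2"
    using weight_gf_NCW_eq[of qvar] unfolding F_def C_def XP .
  hence zero: "fps_X * F ^ 2 + C * (fps_X * P) * (F - 1) ^ 2 - (F - 1) = 0"
    by simp
  \<comment> \<open>Completing the square in the quadratic equation, which has leading coefficient
    \<open>fps_X * (1 + C * P)\<close> and discriminant \<open>D\<close>.\<close>
  have "R ^ 2 - D = 4 * fps_X * (1 + C * P) *
      (fps_X * F ^ 2 + C * (fps_X * P) * (F - 1) ^ 2 - (F - 1))"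
    unfolding R_def D_def XP by (simp add: power2_eq_square algebra_simps)
  hence "R ^ 2 = D"
    unfolding zero by simp
  \<comment> \<open>The constant term 1 selects the branch of the root.\<close>
  moreover have "R $ 0 = 1" "D $ 0 = 1"
    using assms(1,2) by (simp_all add: R_def D_def XP)
  ultimately have "R = fps_sqrt D"
    using fps_sqrt_iff by blast
  hence num: "1 + 2 * C * fps_X ^ (a + b - 1) - fps_sqrt D = 2 * fps_X * (1 + C * P) * F"
    unfolding R_def by (simp add: algebra_simps)
  \<comment> \<open>If \<open>a + b = 2\<close>, then \<open>P = 1\<close> and the constant term of
    \<open>1 + C * P\<close> is \<open>qvar\<close>; otherwise it is 1.\<close>
  have "qvar \<noteq> 0"
    by (simp add: qvar_def)
  hence "(1 + C * P) $ 0 \<noteq> 0"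
    by (cases "a + b = 2") (auto simp: C_def P_def fps_X_power_nth)
  hence "1 + C * P \<noteq> 0"
    by (metis fps_zero_nth)
  hence "2 * fps_X * (1 + C * P) \<noteq> 0"
    by simp
  \<comment> \<open>The denominator is divisible by \<open>fps_X\<close> and hence not invertible,
    but the numerator is a multiple of it, so the quotient is exact.\<close>
  hence "2 * fps_X * (1 + C * P) * F / (2 * fps_X * (1 + C * P)) = F"
    by (rule nonzero_mult_div_cancel_left)
  thus ?thesis
    unfolding F C_def[symmetric] P_def[symmetric] D_def[symmetric] num by (rule sym)
qed

end
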